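(* Let $(P,\mu,\eta,c)$ be an H-group such that $\eta\circ\mu\simeq\mu\circ(\eta\times\eta)\circ T$, where $T:P\times P\to P\times P$ is given by $T(x,y)=(y,x)$. Then $HInn(P)$ is a group.
   Context: An H-group $(P,\mu,\eta,c)$ is a pointed space $(P,p_0)$ with continuous pointed maps $\mu:P\times P\to P$ (multiplication), $\eta:P\to P$ (homotopy inverse) and the constant map $c:P\to P$ at $p_0$ such that $\mu(1_P,c)\simeq\mu(c,1_P)\simeq 1_P$, $\mu(\eta,1_P)\simeq\mu(1_P,\eta)\simeq c$ and $\mu(\mu\times 1_P)\simeq\mu(1_P\times\mu)$ (all of these maps and homotopies being pointed). Here $\simeq$ denotes homotopy of maps. Write $g.h=\mu(g,h)$ and $g^{-1}=\eta(g)$. For $a\in P$ let $\varphi_a:P\to P$ be given by $\varphi_a(g)=a.(g.a^{-1})$. Let $Inn(P)=\{\varphi_a\mid a\in P\}$, with the equivalence relation $\varphi_a\sim\varphi_b\Leftrightarrow\varphi_a\simeq\varphi_b$, and let $HInn(P)=Inn(P)/\sim\;=\{[\varphi_a]\mid a\in P\}$. The binary operation on $HInn(P)$ that is meant is $[\varphi_a][\varphi_b]=[\varphi_{a.b}]$. *)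

theory Defs
  imports "HOL-Analysis.Analysis" "HOL-Algebra.Group"
begin

definition pointed_map :: "'a topology \<Rightarrow> 'a \<Rightarrow> 'b topology \<Rightarrow> 'b \<Rightarrow> ('a \<Rightarrow> 'b) \<Rightarrow> bool" where
  "pointed_map X x0 Y y0 f \<longleftrightarrow> continuous_map X Y f \<and> f x0 = y0"

definition pointed_homotopic ::
  "'a topology \<Rightarrow> 'a \<Rightarrow> 'b topology \<Rightarrow> 'b \<Rightarrow> ('a \<Rightarrow> 'b) \<Rightarrow> ('a \<Rightarrow> 'b) \<Rightarrow> bool" where
  "pointed_homotopic X x0 Y y0 = homotopic_with (\<lambda>h. h x0 = y0) X Y"

text \<open>Homotopy of maps without any condition on base points; the maps \<open>inn_map\<close>
  below do not preserve the base point in general.\<close>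

definition free_homotopic :: "'a topology \<Rightarrow> 'b topology \<Rightarrow> ('a \<Rightarrow> 'b) \<Rightarrow> ('a \<Rightarrow> 'b) \<Rightarrow> bool" where
  "free_homotopic X Y = homotopic_with (\<lambda>_. True) X Y"

text \<open>The constant map \<open>c\<close> is determined by the base point \<open>p0\<close>, so it is not a
  separate parameter.\<close>

locale H_group =
  fixes P :: "'a topology" and p0 :: 'a and \<mu> :: "'a \<times> 'a \<Rightarrow> 'a" and \<eta> :: "'a \<Rightarrow> 'a"
  assumes base_point: "p0 \<in> topspace P"
    and mult_map: "pointed_map (prod_topology P P) (p0, p0) P p0 \<mu>"
    and inverse_map: "pointed_map P p0 P p0 \<eta>"
    and right_unit: "pointed_homotopic P p0 P p0 (\<lambda>x. \<mu> (x, p0)) id"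
    and left_unit: "pointed_homotopic P p0 P p0 (\<lambda>x. \<mu> (p0, x)) id"
    and left_inverse: "pointed_homotopic P p0 P p0 (\<lambda>x. \<mu> (\<eta> x, x)) (\<lambda>_. p0)"
    and right_inverse: "pointed_homotopic P p0 P p0 (\<lambda>x. \<mu> (x, \<eta> x)) (\<lambda>_. p0)"
    and homotopy_assoc:
      "pointed_homotopic (prod_topology P (prod_topology P P)) (p0, p0, p0) P p0
         (\<lambda>(x, y, z). \<mu> (\<mu> (x, y), z)) (\<lambda>(x, y, z). \<mu> (x, \<mu> (y, z)))"

text \<open>The map \<open>\<phi>\<^sub>a\<close>. The restriction makes it a function on the points of the
  space only, so that equality of functions is equality of maps \<open>P \<rightarrow> P\<close>.\<close>

definition inn_map ::
  "'a topology \<Rightarrow> ('a \<times> 'a \<Rightarrow> 'a) \<Rightarrow> ('a \<Rightarrow> 'a) \<Rightarrow> 'a \<Rightarrow> ('a \<Rightarrow> 'a)" where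
  "inn_map P \<mu> \<eta> a = (\<lambda>g\<in>topspace P. \<mu> (a, \<mu> (g, \<eta> a)))"

definition Inn :: "'a topology \<Rightarrow> ('a \<times> 'a \<Rightarrow> 'a) \<Rightarrow> ('a \<Rightarrow> 'a) \<Rightarrow> ('a \<Rightarrow> 'a) set" where
  "Inn P \<mu> \<eta> = inn_map P \<mu> \<eta> ` topspace P"

definition inn_rel ::
  "'a topology \<Rightarrow> ('a \<times> 'a \<Rightarrow> 'a) \<Rightarrow> ('a \<Rightarrow> 'a) \<Rightarrow> (('a \<Rightarrow> 'a) \<times> ('a \<Rightarrow> 'a)) set" where
  "inn_rel P \<mu> \<eta> = {(f, h). f \<in> Inn P \<mu> \<eta> \<and> h \<in> Inn P \<mu> \<eta> \<and> free_homotopic P P f h}"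

definition inn_class ::
  "'a topology \<Rightarrow> ('a \<times> 'a \<Rightarrow> 'a) \<Rightarrow> ('a \<Rightarrow> 'a) \<Rightarrow> 'a \<Rightarrow> ('a \<Rightarrow> 'a) set" where
  "inn_class P \<mu> \<eta> a = inn_rel P \<mu> \<eta> `` {inn_map P \<mu> \<eta> a}"

text \<open>The product of two classes is the union of the classes \<open>[\<phi>\<^bsub>a.b\<^esub>]\<close> over all
  representatives \<open>\<phi>\<^sub>a\<close>, \<open>\<phi>\<^sub>b\<close> of the factors. It is equal to \<open>[\<phi>\<^bsub>a.b\<^esub>]\<close>, for
  every choice of representatives, exactly if the operation \<open>[\<phi>\<^sub>a][\<phi>\<^sub>b] = [\<phi>\<^bsub>a.b\<^esub>]\<close> is
  well defined; otherwise some product is not an equivalence class.\<close>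

definition HInn ::
  "'a topology \<Rightarrow> 'a \<Rightarrow> ('a \<times> 'a \<Rightarrow> 'a) \<Rightarrow> ('a \<Rightarrow> 'a) \<Rightarrow> ('a \<Rightarrow> 'a) set monoid" where
  "HInn P p0 \<mu> \<eta> =
    \<lparr>carrier = Inn P \<mu> \<eta> // inn_rel P \<mu> \<eta>,
     monoid.mult = (\<lambda>A B. \<Union>{inn_class P \<mu> \<eta> (\<mu> (a, b)) | a b.
        a \<in> topspace P \<and> b \<in> topspace P \<and>
        inn_map P \<mu> \<eta> a \<in> A \<and> inn_map P \<mu> \<eta> b \<in> B}),
     one = inn_class P \<mu> \<eta> p0\<rparr>"

end

theory Submission
  imports Defs
begin

text \<open>
  The hypothesis on \<open>\<eta>\<close> gives a path from \<open>(a.b)\<^sup>-\<^sup>1\<close> to \<open>b\<^sup>-\<^sup>1.a\<^sup>-\<^sup>1\<close>, and associativity up to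
  homotopy then yields \<open>\<phi>\<^bsub>a.b\<^esub> \<simeq> \<phi>\<^sub>a \<circ> \<phi>\<^sub>b\<close>. Hence the operation on classes is composition of
  homotopy classes of maps: it is well defined and associative. Points joined by a path have
  homotopic inner maps, so the path from \<open>a\<^sup>-\<^sup>1.a\<close> to \<open>p0\<close> makes \<open>[\<phi>\<^bsub>a\<^sup>-\<^sup>1\<^esub>]\<close> an inverse of
  \<open>[\<phi>\<^sub>a]\<close>, while \<open>\<phi>\<^bsub>p0\<^esub> \<simeq> id\<close>.
\<close>

section \<open>Calculus of free homotopies\<close>

lemma free_homotopic_sym: "free_homotopic X Y f g \<Longrightarrow> free_homotopic X Y g f"
  unfolding free_homotopic_def by (rule homotopic_with_symD)

lemma free_homotopic_trans [trans]:
  "free_homotopic X Y f g \<Longrightarrow> free_homotopic X Y g h \<Longrightarrow> free_homotopic X Y f h"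
  unfolding free_homotopic_def by (rule homotopic_with_trans)

lemma free_homotopic_refl: "continuous_map X Y f \<Longrightarrow> free_homotopic X Y f f"
  unfolding free_homotopic_def by simp

lemma free_homotopic_compose:
  "free_homotopic X Y f f' \<Longrightarrow> free_homotopic Y Z g g' \<Longrightarrow> free_homotopic X Z (g \<circ> f) (g' \<circ> f')"
  unfolding free_homotopic_def by (rule homotopic_compose)

text \<open>With a constant \<open>f\<close> this evaluates a homotopy at a point: the result is a
  homotopy of constant maps, in effect a path.\<close>

lemma free_homotopic_compose_right:
  "free_homotopic Y Z g g' \<Longrightarrow> continuous_map X Y f \<Longrightarrow>
    free_homotopic X Z (\<lambda>x. g (f x)) (\<lambda>x. g' (f x))"
  using free_homotopic_compose [OF free_homotopic_refl] by (fastforce simp: o_def)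

lemma pointed_homotopic_imp_free_homotopic:
  "pointed_homotopic X x0 Y y0 f g \<Longrightarrow> free_homotopic X Y f g"
  unfolding pointed_homotopic_def free_homotopic_def by (erule homotopic_with_mono) simp

text \<open>The product homotopy lives on \<open>X \<times> X\<close>; it is pulled back along the
  diagonal.\<close>

lemma free_homotopic_Pair:
  assumes "free_homotopic X Y f f'" "free_homotopic X Z g g'"
  shows "free_homotopic X (prod_topology Y Z) (\<lambda>x. (f x, g x)) (\<lambda>x. (f' x, g' x))"
proof -
  have "free_homotopic (prod_topology X X) (prod_topology Y Z)
          (\<lambda>z. (f (fst z), g (snd z))) (\<lambda>z. (f' (fst z), g' (snd z)))"
    using assms unfolding free_homotopic_def by (rule homotopic_with_prod_topology) simp
  from free_homotopic_compose_right [OF this, of X "\<lambda>x. (x, x)"] show ?thesis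
    by (simp add: continuous_map_pairedI)
qed

section \<open>Inner maps of an H-group\<close>

context H_group
begin

abbreviation homot :: "('a \<Rightarrow> 'a) \<Rightarrow> ('a \<Rightarrow> 'a) \<Rightarrow> bool"  (infix "\<simeq>" 50) where
  "f \<simeq> g \<equiv> free_homotopic P P f g"

lemma continuous_mult: "continuous_map (prod_topology P P) P \<mu>"
  using mult_map by (simp add: pointed_map_def)

lemma continuous_inverse: "continuous_map P P \<eta>"
  using inverse_map by (simp add: pointed_map_def)

lemma inverse_base: "\<eta> p0 = p0"
  using inverse_map by (simp add: pointed_map_def)

lemma mult_closed: "a \<in> topspace P \<Longrightarrow> b \<in> topspace P \<Longrightarrow> \<mu> (a, b) \<in> topspace P"
  using continuous_map_image_subset_topspace [OF continuous_mult] by auto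

lemma inverse_closed: "a \<in> topspace P \<Longrightarrow> \<eta> a \<in> topspace P"
  using continuous_map_image_subset_topspace [OF continuous_inverse] by auto

lemma homot_const: "a \<in> topspace P \<Longrightarrow> (\<lambda>_. a) \<simeq> (\<lambda>_. a)"
  by (simp add: free_homotopic_refl)

text \<open>Composing the paired homotopy with \<open>\<mu>\<close> makes \<open>\<simeq>\<close> a
  congruence, so that the chains below can rewrite factors inside a product.\<close>

lemma mult_cong:
  "f \<simeq> f' \<Longrightarrow> g \<simeq> g' \<Longrightarrow> (\<lambda>x. \<mu> (f x, g x)) \<simeq> (\<lambda>x. \<mu> (f' x, g' x))"
  using free_homotopic_compose [OF free_homotopic_Pair free_homotopic_refl [OF continuous_mult]]
  by (fastforce simp: o_def)

text \<open>Pullback of \<open>homotopy_assoc\<close> along \<open>(f, g, h)\<close>. Constant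
  components are allowed, so products of fixed points and a variable can be rebracketed.\<close>

lemma mult_assoc:
  assumes "continuous_map P P f" "continuous_map P P g" "continuous_map P P h"
  shows "(\<lambda>x. \<mu> (\<mu> (f x, g x), h x)) \<simeq> (\<lambda>x. \<mu> (f x, \<mu> (g x, h x)))"
  using free_homotopic_compose_right
    [OF pointed_homotopic_imp_free_homotopic [OF homotopy_assoc], of P "\<lambda>x. (f x, g x, h x)"]
  by (simp add: assms continuous_map_pairedI)

lemma continuous_mult_maps:
  "continuous_map P P f \<Longrightarrow> continuous_map P P g \<Longrightarrow> continuous_map P P (\<lambda>x. \<mu> (f x, g x))"
  using continuous_map_compose [OF continuous_map_pairedI continuous_mult] by (fastforce simp: o_def)

abbreviation \<phi> :: "'a \<Rightarrow> 'a \<Rightarrow> 'a" where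
  "\<phi> a \<equiv> inn_map P \<mu> \<eta> a"

lemma inn_map_homot:
  assumes "a \<in> topspace P"
  shows "\<phi> a \<simeq> (\<lambda>g. \<mu> (a, \<mu> (g, \<eta> a)))"
\<comment> \<open>The two maps agree on \<open>topspace P\<close>. The sides are swapped because
  \<open>homotopic_with_equal\<close> asks for continuity of its first map.\<close>
proof (rule free_homotopic_sym, unfold free_homotopic_def, rule homotopic_with_equal)
  show "continuous_map P P (\<lambda>g. \<mu> (a, \<mu> (g, \<eta> a)))"
    by (intro continuous_mult_maps) (use assms inverse_closed in auto)
qed (auto simp: inn_map_def)

lemma inn_map_refl: "a \<in> topspace P \<Longrightarrow> \<phi> a \<simeq> \<phi> a"
  using inn_map_homot free_homotopic_sym free_homotopic_trans by blast

text \<open>A path from \<open>a\<close> to \<open>b\<close>, given as a homotopy of constant maps,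
  is carried by \<open>\<eta>\<close> to a path between the inverses; both are inserted into the
  formula for \<open>\<phi>\<close>.\<close>

lemma inn_map_path_cong:
  assumes "(\<lambda>_. a) \<simeq> (\<lambda>_. b)" "a \<in> topspace P" "b \<in> topspace P"
  shows "\<phi> a \<simeq> \<phi> b"
proof -
  have "(\<lambda>_. \<eta> a) \<simeq> (\<lambda>_. \<eta> b)"
    using free_homotopic_compose [OF assms(1) free_homotopic_refl [OF continuous_inverse]]
    by (simp add: o_def)
  then have "(\<lambda>g. \<mu> (a, \<mu> (g, \<eta> a))) \<simeq> (\<lambda>g. \<mu> (b, \<mu> (g, \<eta> b)))"
    by (intro mult_cong assms(1)) (simp_all add: free_homotopic_refl)
  then show ?thesis
    using inn_map_homot assms(2,3) free_homotopic_sym free_homotopic_trans by meson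
qed

lemma inn_map_base: "\<phi> p0 \<simeq> id"
proof -
  \<comment> \<open>\<open>\<eta>\<close> fixes \<open>p0\<close> exactly, so this replacement costs
    no homotopy.\<close>
  have "\<phi> p0 \<simeq> (\<lambda>g. \<mu> (p0, \<mu> (g, p0)))"
    using inn_map_homot [OF base_point] by (simp add: inverse_base)
  also have "\<dots> \<simeq> (\<lambda>g. \<mu> (p0, id g))"
    by (intro mult_cong homot_const base_point
        pointed_homotopic_imp_free_homotopic [OF right_unit])
  also have "\<dots> \<simeq> id"
    using pointed_homotopic_imp_free_homotopic [OF left_unit] by simp
  finally show ?thesis .
qed

lemma inn_map_left_inverse:
  assumes "a \<in> topspace P"
  shows "\<phi> (\<mu> (\<eta> a, a)) \<simeq> \<phi> p0"
proof (rule inn_map_path_cong)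
  show "(\<lambda>_. \<mu> (\<eta> a, a)) \<simeq> (\<lambda>_. p0)"
    using free_homotopic_compose_right
      [OF pointed_homotopic_imp_free_homotopic [OF left_inverse], of P "\<lambda>_. a"] assms by simp
qed (use assms mult_closed inverse_closed base_point in auto)

lemma equiv_inn_rel: "equiv (Inn P \<mu> \<eta>) (inn_rel P \<mu> \<eta>)"
proof (rule equivI)
  show "inn_rel P \<mu> \<eta> \<subseteq> Inn P \<mu> \<eta> \<times> Inn P \<mu> \<eta>"
    by (auto simp: inn_rel_def)
  show "refl_on (Inn P \<mu> \<eta>) (inn_rel P \<mu> \<eta>)"
    by (auto simp: refl_on_def inn_rel_def Inn_def inn_map_refl)
  show "sym (inn_rel P \<mu> \<eta>)"
    by (auto simp: sym_def inn_rel_def intro: free_homotopic_sym)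
  show "trans (inn_rel P \<mu> \<eta>)"
    by (auto simp: trans_def inn_rel_def intro: free_homotopic_trans)
qed

text \<open>Turns each group law for classes into a homotopy of inner maps.\<close>

lemma inn_class_eq_iff:
  assumes "a \<in> topspace P" "b \<in> topspace P"
  shows "inn_class P \<mu> \<eta> a = inn_class P \<mu> \<eta> b \<longleftrightarrow> \<phi> a \<simeq> \<phi> b"
  unfolding inn_class_def
  using assms by (subst eq_equiv_class_iff [OF equiv_inn_rel]) (auto simp: Inn_def inn_rel_def)

lemma carrier_HInn: "carrier (HInn P p0 \<mu> \<eta>) = inn_class P \<mu> \<eta> ` topspace P"
  by (auto simp: HInn_def quotient_def Inn_def inn_class_def)

lemma one_HInn: "\<one>\<^bsub>HInn P p0 \<mu> \<eta>\<^esub> = inn_class P \<mu> \<eta> p0"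
  by (simp add: HInn_def)

end

section \<open>Consequences of the hypothesis on inverses\<close>

locale H_group_antihom = H_group +
  assumes inverse_mult:
    "free_homotopic (prod_topology P P) P (\<eta> \<circ> \<mu>) (\<mu> \<circ> map_prod \<eta> \<eta> \<circ> prod.swap)"
begin

lemma inn_map_mult:
  assumes a: "a \<in> topspace P" and b: "b \<in> topspace P"
  shows "\<phi> (\<mu> (a, b)) \<simeq> \<phi> a \<circ> \<phi> b"
proof -
  note ab = mult_closed [OF a b]
  note ia = inverse_closed [OF a]
  note ib = inverse_closed [OF b]
  have cont: "continuous_map P P (\<lambda>x. x)" "continuous_map P P (\<lambda>_. a)"
    "continuous_map P P (\<lambda>_. b)" "continuous_map P P (\<lambda>_. \<eta> a)" "continuous_map P P (\<lambda>_. \<eta> b)"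
    using a b ia ib by auto
  note refl = cont [THEN free_homotopic_refl]
  note maps = cont continuous_mult_maps
  \<comment> \<open>The hypothesis is pulled back along the constant map at \<open>(a, b)\<close>;
    the swap puts \<open>\<eta> b\<close> first.\<close>
  have inv: "(\<lambda>_. \<eta> (\<mu> (a, b))) \<simeq> (\<lambda>_. \<mu> (\<eta> b, \<eta> a))"
    using free_homotopic_compose_right [OF inverse_mult, of P "\<lambda>_. (a, b)"] a b by simp
  have "\<phi> (\<mu> (a, b)) \<simeq> (\<lambda>g. \<mu> (\<mu> (a, b), \<mu> (g, \<eta> (\<mu> (a, b)))))"
    by (rule inn_map_homot [OF ab])
  also have "\<dots> \<simeq> (\<lambda>g. \<mu> (\<mu> (a, b), \<mu> (g, \<mu> (\<eta> b, \<eta> a))))"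
    by (intro mult_cong refl inv)
  \<comment> \<open>Three rebracketings enclose \<open>g\<close> between \<open>b\<close> and
    \<open>\<eta> b\<close>, so that \<open>\<phi> b\<close> appears inside \<open>\<phi> a\<close>.
    The first and third use associativity from right to left.\<close>
  also have "\<dots> \<simeq> (\<lambda>g. \<mu> (\<mu> (a, b), \<mu> (\<mu> (g, \<eta> b), \<eta> a)))"
    by (rule free_homotopic_sym, intro mult_cong mult_assoc refl maps)
  also have "\<dots> \<simeq> (\<lambda>g. \<mu> (a, \<mu> (b, \<mu> (\<mu> (g, \<eta> b), \<eta> a))))"
    by (intro mult_assoc maps)
  also have "\<dots> \<simeq> (\<lambda>g. \<mu> (a, \<mu> (\<mu> (b, \<mu> (g, \<eta> b)), \<eta> a)))"
    by (rule free_homotopic_sym, intro mult_cong mult_assoc refl maps)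
  also have "\<dots> \<simeq> \<phi> a \<circ> \<phi> b"
    using free_homotopic_sym [OF free_homotopic_compose [OF inn_map_homot [OF b] inn_map_homot [OF a]]]
    by (simp add: o_def)
  finally show ?thesis .
qed

text \<open>This is well-definedness. A homotopy from \<open>\<phi> a\<close> to
  \<open>\<phi> a'\<close> provides no path from \<open>a\<close> to \<open>a'\<close>, so the
  argument passes through composition, which respects homotopy.\<close>

lemma inn_map_mult_cong:
  assumes "a \<in> topspace P" "b \<in> topspace P" "a' \<in> topspace P" "b' \<in> topspace P"
    and "\<phi> a \<simeq> \<phi> a'" "\<phi> b \<simeq> \<phi> b'"
  shows "\<phi> (\<mu> (a, b)) \<simeq> \<phi> (\<mu> (a', b'))"
proof -
  have "\<phi> (\<mu> (a, b)) \<simeq> \<phi> a \<circ> \<phi> b"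
    using assms by (intro inn_map_mult)
  also have "\<dots> \<simeq> \<phi> a' \<circ> \<phi> b'"
    using assms by (intro free_homotopic_compose [where Y = P])
  also have "\<dots> \<simeq> \<phi> (\<mu> (a', b'))"
    using assms by (intro free_homotopic_sym [OF inn_map_mult])
  finally show ?thesis .
qed

text \<open>Inherited from composition of maps, which is strictly associative.\<close>

lemma inn_map_mult_assoc:
  assumes "a \<in> topspace P" "b \<in> topspace P" "c \<in> topspace P"
  shows "\<phi> (\<mu> (\<mu> (a, b), c)) \<simeq> \<phi> (\<mu> (a, \<mu> (b, c)))"
proof -
  note refl = inn_map_refl [OF assms(1)] inn_map_refl [OF assms(3)]
  have "\<phi> (\<mu> (\<mu> (a, b), c)) \<simeq> \<phi> (\<mu> (a, b)) \<circ> \<phi> c"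
    using assms by (intro inn_map_mult mult_closed)
  also have "\<dots> \<simeq> (\<phi> a \<circ> \<phi> b) \<circ> \<phi> c"
    using assms by (intro free_homotopic_compose [where Y = P] inn_map_mult refl)
  also have "(\<phi> a \<circ> \<phi> b) \<circ> \<phi> c = \<phi> a \<circ> (\<phi> b \<circ> \<phi> c)"
    by (rule comp_assoc)
  also have "\<phi> a \<circ> (\<phi> b \<circ> \<phi> c) \<simeq> \<phi> a \<circ> \<phi> (\<mu> (b, c))"
    using assms by (intro free_homotopic_compose [where Y = P] refl free_homotopic_sym [OF inn_map_mult])
  also have "\<dots> \<simeq> \<phi> (\<mu> (a, \<mu> (b, c)))"
    using assms by (intro free_homotopic_sym [OF inn_map_mult] mult_closed)
  finally show ?thesis .
qed

lemma inn_map_left_unit: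
  assumes "a \<in> topspace P"
  shows "\<phi> (\<mu> (p0, a)) \<simeq> \<phi> a"
proof -
  have "\<phi> (\<mu> (p0, a)) \<simeq> \<phi> p0 \<circ> \<phi> a"
    using assms base_point by (intro inn_map_mult)
  also have "\<dots> \<simeq> id \<circ> \<phi> a"
    using assms by (intro free_homotopic_compose [where Y = P] inn_map_base inn_map_refl)
  finally show ?thesis by simp
qed

text \<open>By well-definedness, the family whose union defines the product contains one class
  only.\<close>

lemma mult_HInn:
  assumes "a \<in> topspace P" "b \<in> topspace P"
  shows "inn_class P \<mu> \<eta> a \<otimes>\<^bsub>HInn P p0 \<mu> \<eta>\<^esub> inn_class P \<mu> \<eta> b = inn_class P \<mu> \<eta> (\<mu> (a, b))"
proof -
  have mem: "\<phi> x \<in> inn_class P \<mu> \<eta> y \<longleftrightarrow> \<phi> y \<simeq> \<phi> x"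
    if "x \<in> topspace P" "y \<in> topspace P" for x y
    using that by (auto simp: inn_class_def inn_rel_def Inn_def)
  have "{inn_class P \<mu> \<eta> (\<mu> (x, y)) | x y. x \<in> topspace P \<and> y \<in> topspace P \<and>
          \<phi> x \<in> inn_class P \<mu> \<eta> a \<and> \<phi> y \<in> inn_class P \<mu> \<eta> b} = {inn_class P \<mu> \<eta> (\<mu> (a, b))}"
    (is "?C = _")
  proof (rule equalityI)
    show "?C \<subseteq> {inn_class P \<mu> \<eta> (\<mu> (a, b))}"
    proof clarify
      fix x y
      assume "x \<in> topspace P" "y \<in> topspace P"
        "\<phi> x \<in> inn_class P \<mu> \<eta> a" "\<phi> y \<in> inn_class P \<mu> \<eta> b"
      with assms have "\<phi> (\<mu> (x, y)) \<simeq> \<phi> (\<mu> (a, b))"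
        by (intro inn_map_mult_cong) (simp_all add: mem free_homotopic_sym)
      then show "inn_class P \<mu> \<eta> (\<mu> (x, y)) = inn_class P \<mu> \<eta> (\<mu> (a, b))"
        using \<open>x \<in> topspace P\<close> \<open>y \<in> topspace P\<close> assms by (simp add: inn_class_eq_iff mult_closed)
    qed
    \<comment> \<open>\<open>a\<close> and \<open>b\<close> represent their own classes, so the
      family is not empty.\<close>
    show "{inn_class P \<mu> \<eta> (\<mu> (a, b))} \<subseteq> ?C"
      using assms mem [of a a] mem [of b b] inn_map_refl by blast
  qed
  then show ?thesis
    by (simp add: HInn_def)
qed

lemma group_HInn: "group (HInn P p0 \<mu> \<eta>)"
\<comment> \<open>Besides closure and associativity, \<open>groupI\<close> asks for a left unit and
  left inverses only.\<close>
proof (rule groupI)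
  fix x assume "x \<in> carrier (HInn P p0 \<mu> \<eta>)"
  then obtain a where a: "a \<in> topspace P" "x = inn_class P \<mu> \<eta> a"
    by (auto simp: carrier_HInn)
  show "\<one>\<^bsub>HInn P p0 \<mu> \<eta>\<^esub> \<otimes>\<^bsub>HInn P p0 \<mu> \<eta>\<^esub> x = x"
    using a base_point by (simp add: one_HInn mult_HInn inn_class_eq_iff mult_closed inn_map_left_unit)
  \<comment> \<open>Once the carrier is rewritten as an image, the witness is the point
    \<open>\<eta> a\<close> rather than its class.\<close>
  show "\<exists>y\<in>carrier (HInn P p0 \<mu> \<eta>). y \<otimes>\<^bsub>HInn P p0 \<mu> \<eta>\<^esub> x = \<one>\<^bsub>HInn P p0 \<mu> \<eta>\<^esub>"
    using a base_point
    by (auto simp: one_HInn carrier_HInn mult_HInn inn_class_eq_iff mult_closed inverse_closed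
        inn_map_left_inverse intro!: bexI [of _ "\<eta> a"])
next
  fix x y z
  assume "x \<in> carrier (HInn P p0 \<mu> \<eta>)" "y \<in> carrier (HInn P p0 \<mu> \<eta>)"
    "z \<in> carrier (HInn P p0 \<mu> \<eta>)"
  then obtain a b c where "a \<in> topspace P" "b \<in> topspace P" "c \<in> topspace P"
    "x = inn_class P \<mu> \<eta> a" "y = inn_class P \<mu> \<eta> b" "z = inn_class P \<mu> \<eta> c"
    by (auto simp: carrier_HInn)
  then show "x \<otimes>\<^bsub>HInn P p0 \<mu> \<eta>\<^esub> y \<otimes>\<^bsub>HInn P p0 \<mu> \<eta>\<^esub> z =
      x \<otimes>\<^bsub>HInn P p0 \<mu> \<eta>\<^esub> (y \<otimes>\<^bsub>HInn P p0 \<mu> \<eta>\<^esub> z)"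
    by (simp add: mult_HInn inn_class_eq_iff mult_closed inn_map_mult_assoc)
qed (use base_point in \<open>auto simp: carrier_HInn one_HInn mult_HInn mult_closed\<close>)

end

text \<open>The first two conjuncts tie the group to the intended object: its carrier is a quotient
  by an equivalence, and the formula for all representatives \<open>a\<close>, \<open>b\<close> says
  that the operation is well defined.\<close>

theorem theorem4p17:
  fixes P :: "'a topology" and p0 :: 'a and \<mu> :: "'a \<times> 'a \<Rightarrow> 'a" and \<eta> :: "'a \<Rightarrow> 'a"
  assumes "H_group P p0 \<mu> \<eta>"
    and "free_homotopic (prod_topology P P) P (\<eta> \<circ> \<mu>) (\<mu> \<circ> map_prod \<eta> \<eta> \<circ> prod.swap)"
  shows "equiv (Inn P \<mu> \<eta>) (inn_rel P \<mu> \<eta>)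
    \<and> (\<forall>a\<in>topspace P. \<forall>b\<in>topspace P.
        inn_class P \<mu> \<eta> a \<otimes>\<^bsub>HInn P p0 \<mu> \<eta>\<^esub> inn_class P \<mu> \<eta> b = inn_class P \<mu> \<eta> (\<mu> (a, b)))
    \<and> group (HInn P p0 \<mu> \<eta>)"
proof -
  interpret H_group_antihom P p0 \<mu> \<eta>
    using assms by (simp add: H_group_antihom_def H_group_antihom_axioms_def)
  show ?thesis
    using equiv_inn_rel mult_HInn group_HInn by blast
qed

end
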